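(* Let $P_{GEV}$ be a generalized extreme value (GEV) probability measure on $\mathbb{R}$ with shape parameter $\gamma_{\mathrm{ref}}\in\mathbb{R}$, i.e. its distribution function is $F(x) := P_{GEV}(-\infty,x] = G_{\gamma_{\mathrm{ref}}}(a_0x+b_0)$ for some $a_0>0$, $b_0\in\mathbb{R}$. Then, with $x_F^* := \sup\{x: F(x)<1\}$, the second derivative $F''(x)$ exists and $F'(x)$ is positive for all $x$ in some left neighborhood of $x_F^*$, and $$\lim_{x\uparrow x_F^*}\left(\frac{1-F}{F'}\right)'(x) = \gamma_{\mathrm{ref}}.$$ Moreover, for any $\alpha>1$ and $\delta>0$, let $$\bar F_{\alpha,\delta}(x) := \sup\{P(x,\infty) : D_\alpha(P,P_{GEV})\le\delta\},\quad x \in \mathbb{R}, \qquad\text{and}\qquad \gamma^* := \frac{\alpha}{\alpha-1}\,\gamma_{\mathrm{ref}}.$$ Then the distribution function $F_{\alpha,\delta}(x) = 1-\bar F_{\alpha,\delta}(x)$ belongs to the domain of attraction of $G_{\gamma^*}$.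
   Context: For $\alpha>1$ and probability measures $P, Q$ on $(\mathbb{R},\mathcal{B}(\mathbb{R}))$ with $P$ absolutely continuous with respect to $Q$, the Rényi divergence of degree $\alpha$ is $D_\alpha(P,Q) := \frac{1}{\alpha-1}\log E_Q\left[\left(\frac{dP}{dQ}\right)^\alpha\right]$; if $P$ is not absolutely continuous with respect to $Q$, then $D_\alpha(P,Q) := \infty$. The supremum defining $\bar F_{\alpha,\delta}$ is over all Borel probability measures $P$ on $\mathbb{R}$. For $\gamma\in\mathbb{R}$, the extreme value distribution is $G_\gamma(x) := \exp\left(-(1+\gamma x)^{-1/\gamma}\right)$ for $1+\gamma x>0$, interpreted as $\exp(-\exp(-x))$ when $\gamma=0$ (outside $\{1+\gamma x>0\}$, $G_\gamma$ is extended as a distribution function: $0$ if $\gamma>0$, $1$ if $\gamma<0$). A distribution function $F$ belongs to the (maximum) domain of attraction of $G_\gamma$ if there are constants $a_n>0$, $b_n\in\mathbb{R}$ and $a>0$, $b\in\mathbb{R}$ such that $\lim_{n\to\infty}F^n(a_nx+b_n)=G_\gamma(ax+b)$ for every continuity point $x$ of the limit. *)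

theory Defs
  imports "HOL-Probability.Probability"
begin

(* The library's RN_deriv takes values in [0, infinity]; for probability measures it is finite
   almost everywhere, so applying enn2real changes it only on a null set. The expectation is a
   nonnegative Lebesgue integral and may be infinite, in which case its logarithm is infinity. *)
definition renyi_divergence :: "real \<Rightarrow> 'a measure \<Rightarrow> 'a measure \<Rightarrow> ereal" where
  "renyi_divergence \<alpha> P Q =
     (if absolutely_continuous Q P
      then let I = (\<integral>\<^sup>+ x. ennreal (enn2real (RN_deriv Q P x) powr \<alpha>) \<partial>Q)
           in if I = \<infinity> then \<infinity> else ereal (1 / (\<alpha> - 1) * ln (enn2real I))
      else \<infinity>)"

definition worst_case_tail :: "real \<Rightarrow> real \<Rightarrow> real measure \<Rightarrow> real \<Rightarrow> real" where
  "worst_case_tail \<alpha> \<delta> Q x =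
     (SUP P \<in> {P. real_distribution P \<and> renyi_divergence \<alpha> P Q \<le> ereal \<delta>}. measure P {x<..})"

definition extreme_value_cdf :: "real \<Rightarrow> real \<Rightarrow> real" where
  "extreme_value_cdf \<gamma> x =
     (if \<gamma> = 0 then exp (- exp (- x))
      else if 1 + \<gamma> * x > 0 then exp (- ((1 + \<gamma> * x) powr (- 1 / \<gamma>)))
      else if \<gamma> > 0 then 0 else 1)"

definition is_distribution_function :: "(real \<Rightarrow> real) \<Rightarrow> bool" where
  "is_distribution_function F \<longleftrightarrow> (\<exists>M. real_distribution M \<and> F = cdf M)"

definition in_max_domain_of_attraction :: "(real \<Rightarrow> real) \<Rightarrow> real \<Rightarrow> bool" where
  "in_max_domain_of_attraction F \<gamma> \<longleftrightarrow>
     is_distribution_function F \<and>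
     (\<exists>(an :: nat \<Rightarrow> real) (bn :: nat \<Rightarrow> real) (a :: real) (b :: real).
        (\<forall>n. an n > 0) \<and> a > 0 \<and>
        (\<forall>x. isCont (\<lambda>t. extreme_value_cdf \<gamma> (a * t + b)) x \<longrightarrow>
           (\<lambda>n. F (an n * x + bn n) ^ n) \<longlonglongrightarrow> extreme_value_cdf \<gamma> (a * x + b)))"

(* Taken in the extended reals, since the right endpoint may be infinity. *)
definition right_endpoint :: "(real \<Rightarrow> real) \<Rightarrow> ereal" where
  "right_endpoint F = (SUP x \<in> {x. F x < 1}. ereal x)"

end

theory Submission
  imports Defs
begin

text \<open>
  Write the distribution function as \<open>F = exp (- u)\<close> with \<open>u x = gev_exponent \<gamma> (a x + b)\<close>, where
  \<open>\<gamma> = \<gamma>_ref\<close>, \<open>a = a0\<close> and \<open>b = b0\<close>. For every \<open>\<gamma>\<close>, zero included, \<open>u' = - a u powr (1 + \<gamma>)\<close> on the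
  support, whence \<open>((1 - F) / F')' = - exp u + (1 + \<gamma>) (exp u - 1) / u\<close>. As \<open>x\<close> increases to the
  right endpoint, \<open>u\<close> tends to \<open>0\<close> and this expression to \<open>- 1 + (1 + \<gamma>) = \<gamma>\<close>.

  For the worst case, let \<open>q = Q (x, \<infinity>)\<close>, \<open>K = exp ((\<alpha> - 1) \<delta>)\<close> and \<open>\<beta> = (\<alpha> - 1) / \<alpha>\<close>. Convexity of
  \<open>t powr \<alpha>\<close> shows that every \<open>P\<close> in the Renyi ball has a tail probability \<open>p = P (x, \<infinity>)\<close> with
  \<open>p powr \<alpha> * q powr (1 - \<alpha>) + (1 - p) powr \<alpha> * (1 - q) powr (1 - \<alpha>) \<le> K\<close>
  (\<open>renyi_ball_bound\<close>), and conversely, for \<open>0 < q < 1\<close>, each such \<open>p\<close> in \<open>[0, 1]\<close> is attained by a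
  density that is constant on \<open>(x, \<infinity>)\<close> and on its complement (\<open>renyi_ball_two_valued\<close>). As \<open>q\<close> tends to \<open>0\<close> the second summand
  tends to \<open>1\<close>, so the worst-case tail is asymptotic to \<open>c q powr \<beta>\<close> with
  \<open>c = (K - 1) powr (1 / \<alpha>)\<close> (\<open>worst_case_tail_asymptotics\<close>).

  Near the endpoint \<open>q\<close> is asymptotic to \<open>u\<close>, and \<open>gev_exponent \<gamma> y powr \<beta> =
  gev_exponent (\<gamma> / \<beta>) (\<beta> y)\<close>. The worst-case tail is thus asymptotic to \<open>c\<close> times a GEV exponent
  of shape \<open>\<gamma> / \<beta> = \<alpha> / (\<alpha> - 1) * \<gamma>\<close>. An affine substitution divides such an exponent by \<open>n c\<close>
  (\<open>gev_exponent_norming\<close>), and the \<open>n\<close>-th powers converge because \<open>(1 - w n) ^ n\<close> tends to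
  \<open>exp (- v)\<close> whenever \<open>n w n\<close> tends to \<open>v\<close>.
\<close>

section \<open>Exponential limits\<close>

lemma tendsto_exp_minus_one_divide: "((\<lambda>v. (exp v - 1) / v) \<longlongrightarrow> 1) (at (0::real))"
  using DERIV_exp[of "0::real"] by (simp add: DERIV_def)

lemma one_minus_exp_minus_asymp: "((\<lambda>v. (1 - exp (- v)) / v) \<longlongrightarrow> 1) (at (0::real))"
proof -
  have "filterlim uminus (at 0) (at (0::real))"
    by (auto simp: filterlim_at eventually_at_filter intro!: tendsto_eq_intros)
  from filterlim_compose[OF tendsto_exp_minus_one_divide this]
  have "((\<lambda>v. (exp (- v) - 1) / (- v)) \<longlongrightarrow> 1) (at (0::real))" .
  moreover have "(exp (- v) - 1) / (- v) = (1 - exp (- v)) / v" for v :: real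
    by (metis minus_diff_eq minus_divide_divide minus_minus)
  ultimately show ?thesis by simp
qed

lemma one_minus_power_tendsto_exp:
  fixes w :: "nat \<Rightarrow> real"
  assumes lim: "(\<lambda>n. real n * w n) \<longlonglongrightarrow> v" and nonneg: "eventually (\<lambda>n. w n \<ge> 0) sequentially"
  shows "(\<lambda>n. (1 - w n) ^ n) \<longlonglongrightarrow> exp (- v)"
proof -
  have "(\<lambda>n. real n * w n * (1 / real n)) \<longlonglongrightarrow> v * 0"
    by (intro tendsto_mult lim lim_1_over_n)
  moreover have "eventually (\<lambda>n. real n * w n * (1 / real n) = w n) sequentially"
    using eventually_gt_at_top[of 0] by eventually_elim simp
  ultimately have w0: "w \<longlonglongrightarrow> 0"
    by (auto dest: Lim_transform_eventually)
  have small: "eventually (\<lambda>n. w n < 1 / 2) sequentially"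
    using w0 by (rule order_tendstoD) simp
  have "(\<lambda>n. real n * ln (1 - w n)) \<longlonglongrightarrow> - v"
  proof (rule tendsto_sandwich)
    show "eventually (\<lambda>n. - (real n * w n) - 2 * (real n * w n) * w n \<le> real n * ln (1 - w n)) sequentially"
      using small nonneg
    proof eventually_elim
      case (elim n)
      then have "real n * (- w n - 2 * (w n)\<^sup>2) \<le> real n * ln (1 - w n)"
        by (intro mult_left_mono ln_one_minus_pos_lower_bound) auto
      then show ?case by (simp add: algebra_simps power2_eq_square)
    qed
    show "eventually (\<lambda>n. real n * ln (1 - w n) \<le> - (real n * w n)) sequentially"
      using small nonneg
    proof eventually_elim
      case (elim n)
      then have "real n * ln (1 - w n) \<le> real n * (- w n)"
        by (intro mult_left_mono ln_one_minus_pos_upper_bound) auto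
      then show ?case by simp
    qed
    have "(\<lambda>n. - (real n * w n) - 2 * (real n * w n) * w n) \<longlonglongrightarrow> - v - 2 * v * 0"
      by (intro tendsto_intros lim w0)
    then show "(\<lambda>n. - (real n * w n) - 2 * (real n * w n) * w n) \<longlonglongrightarrow> - v" by simp
    show "(\<lambda>n. - (real n * w n)) \<longlonglongrightarrow> - v" by (intro tendsto_intros lim)
  qed
  then have "(\<lambda>n. exp (real n * ln (1 - w n))) \<longlonglongrightarrow> exp (- v)"
    by (rule tendsto_exp)
  moreover have "eventually (\<lambda>n. exp (real n * ln (1 - w n)) = (1 - w n) ^ n) sequentially"
    using small by eventually_elim (simp add: exp_of_nat_mult)
  ultimately show ?thesis by (simp cong: tendsto_cong)
qed

section \<open>Tail probabilities in a Renyi ball\<close>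

text \<open>
  With \<open>ln 0 = 0\<close> a vanishing integral has divergence \<open>0\<close>; both inequalities then hold since \<open>\<delta> \<ge> 0\<close>.
\<close>
lemma renyi_divergence_le_iff:
  fixes \<alpha> \<delta> :: real
  assumes "\<alpha> > 1" "\<delta> \<ge> 0"
  shows "renyi_divergence \<alpha> P Q \<le> ereal \<delta> \<longleftrightarrow>
    absolutely_continuous Q P \<and>
    (\<integral>\<^sup>+ x. ennreal (enn2real (RN_deriv Q P x) powr \<alpha>) \<partial>Q) \<le> ennreal (exp ((\<alpha> - 1) * \<delta>))"
proof -
  define I where "I = (\<integral>\<^sup>+ x. ennreal (enn2real (RN_deriv Q P x) powr \<alpha>) \<partial>Q)"
  have "ereal (1 / (\<alpha> - 1) * ln (enn2real I)) \<le> ereal \<delta> \<longleftrightarrow> I \<le> ennreal (exp ((\<alpha> - 1) * \<delta>))"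
    if "I \<noteq> \<infinity>"
  proof -
    obtain r where r: "r \<ge> 0" "I = ennreal r"
      using \<open>I \<noteq> \<infinity>\<close> by (cases I) auto
    show ?thesis
    proof (cases "r = 0")
      case True
      then show ?thesis using r assms by simp
    next
      case False
      then have "ln r \<le> (\<alpha> - 1) * \<delta> \<longleftrightarrow> r \<le> exp ((\<alpha> - 1) * \<delta>)"
        using r(1) by (metis exp_le_cancel_iff exp_ln less_eq_real_def)
      moreover have "1 / (\<alpha> - 1) * ln r \<le> \<delta> \<longleftrightarrow> ln r \<le> (\<alpha> - 1) * \<delta>"
        using assms by (simp add: field_simps)
      ultimately show ?thesis using r by simp
    qed
  qed
  then show ?thesis
    unfolding renyi_divergence_def Let_def I_def[symmetric] by (auto simp: top_unique)
qed

lemma powr_ge_tangent: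
  fixes s t \<alpha> :: real
  assumes "\<alpha> > 1" "s > 0" "t \<ge> 0"
  shows "s powr \<alpha> + \<alpha> * s powr (\<alpha> - 1) * (t - s) \<le> t powr \<alpha>"
proof (cases "t = 0")
  case True
  have "s powr (\<alpha> - 1) * s = s powr \<alpha>"
    using assms by (simp add: powr_diff)
  then have "s powr \<alpha> + \<alpha> * s powr (\<alpha> - 1) * (t - s) = (1 - \<alpha>) * s powr \<alpha>"
    using True by (simp add: algebra_simps)
  also have "\<dots> \<le> 0" using assms by (simp add: mult_nonpos_nonneg)
  finally show ?thesis using True by simp
next
  case False
  have "t powr \<alpha> - s powr \<alpha> \<ge> \<alpha> * s powr (\<alpha> - 1) * (t - s)"
  proof (rule convex_on_imp_above_tangent[where A = "{0<..}"])
    show "convex_on {0<..} (\<lambda>x. x powr \<alpha>)" using assms by (simp add: powr_convex)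
    show "((\<lambda>x. x powr \<alpha>) has_field_derivative \<alpha> * s powr (\<alpha> - 1)) (at s within {0<..})"
      using assms by (auto intro!: derivative_eq_intros)
  qed (use assms False in \<open>auto simp: is_interval_connected interior_open\<close>)
  then show ?thesis by simp
qed

text \<open>
  Jensen's inequality on \<open>A\<close>, with powers of \<open>measure M A\<close> in place of normalization, so that a
  null set needs no exception.
\<close>
lemma (in finite_measure) powr_integral_le:
  fixes f :: "'a \<Rightarrow> real"
  assumes \<alpha>: "\<alpha> > 1" and A: "A \<in> sets M"
    and f: "integrable M f" "\<And>x. f x \<ge> 0" "integrable M (\<lambda>x. f x powr \<alpha>)"
  shows "(\<integral>x. f x * indicator A x \<partial>M) powr \<alpha> * measure M A powr (1 - \<alpha>)
    \<le> (\<integral>x. f x powr \<alpha> * indicator A x \<partial>M)"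
proof -
  define p where "p = (\<integral>x. f x * indicator A x \<partial>M)"
  define q where "q = measure M A"
  have p: "p \<ge> 0" unfolding p_def using f by (intro integral_nonneg_AE) auto
  have q: "q \<ge> 0" unfolding q_def by simp
  have [simp]: "integrable M (\<lambda>x. f x * indicator A x)"
    "integrable M (\<lambda>x. f x powr \<alpha> * indicator A x)" "integrable M (indicat_real A)"
    using A f by (auto intro: integrable_real_mult_indicator integrable_const_bound[where B = 1])
  show ?thesis
  proof (cases "p = 0 \<or> q = 0")
    case True
    then have "p powr \<alpha> * q powr (1 - \<alpha>) = 0" by auto
    moreover have "0 \<le> (\<integral>x. f x powr \<alpha> * indicator A x \<partial>M)"
      by (intro integral_nonneg_AE) auto
    ultimately show ?thesis unfolding p_def[symmetric] q_def[symmetric] by linarith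
  next
    case False
    define s where "s = p / q"
    have s: "s > 0" using False p q by (simp add: s_def)
    \<comment> \<open>The tangent at the mean value of \<open>f\<close> over \<open>A\<close>: its linear term integrates to zero.\<close>
    have "(\<integral>x. (s powr \<alpha> - \<alpha> * s powr (\<alpha> - 1) * s) * indicator A x
        + \<alpha> * s powr (\<alpha> - 1) * (f x * indicator A x) \<partial>M)
      \<le> (\<integral>x. f x powr \<alpha> * indicator A x \<partial>M)"
    proof (rule integral_mono)
      fix x
      show "(s powr \<alpha> - \<alpha> * s powr (\<alpha> - 1) * s) * indicator A x
        + \<alpha> * s powr (\<alpha> - 1) * (f x * indicator A x) \<le> f x powr \<alpha> * indicator A x"
        using powr_ge_tangent[OF \<alpha> s f(2)[of x]] by (auto simp: indicator_def algebra_simps)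
    qed (use A in simp_all)
    also have "(\<integral>x. (s powr \<alpha> - \<alpha> * s powr (\<alpha> - 1) * s) * indicator A x
        + \<alpha> * s powr (\<alpha> - 1) * (f x * indicator A x) \<partial>M)
      = (s powr \<alpha> - \<alpha> * s powr (\<alpha> - 1) * s) * q + \<alpha> * s powr (\<alpha> - 1) * p"
      using A by (simp add: p_def q_def)
    also have "\<dots> = s powr \<alpha> * q"
      using False by (simp add: s_def field_simps)
    also have "\<dots> = p powr \<alpha> * q powr (1 - \<alpha>)"
      using False p q by (simp add: s_def powr_divide powr_diff)
    finally show ?thesis by (simp add: p_def q_def)
  qed
qed

text \<open>
  Among measures with a given mass on \<open>A\<close>, the one whose density is constant on \<open>A\<close> and on its
  complement minimizes the divergence; the left-hand side is its value of the defining integral.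
\<close>
lemma renyi_ball_bound:
  assumes "prob_space P" "prob_space Q" and sets: "sets P = sets Q" and "\<alpha> > 1" "\<delta> \<ge> 0"
    and "renyi_divergence \<alpha> P Q \<le> ereal \<delta>" and A: "A \<in> sets Q"
  shows "measure P A powr \<alpha> * measure Q A powr (1 - \<alpha>)
      + (1 - measure P A) powr \<alpha> * (1 - measure Q A) powr (1 - \<alpha>) \<le> exp ((\<alpha> - 1) * \<delta>)"
proof -
  interpret P: prob_space P by fact
  interpret Q: prob_space Q by fact
  define f where "f x = enn2real (RN_deriv Q P x)" for x
  have ac: "absolutely_continuous Q P"
    and I: "(\<integral>\<^sup>+ x. ennreal (f x powr \<alpha>) \<partial>Q) \<le> ennreal (exp ((\<alpha> - 1) * \<delta>))"
    using assms by (auto simp: renyi_divergence_le_iff f_def)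
  have [measurable]: "f \<in> borel_measurable Q" by (simp add: f_def[abs_def])
  have f0: "f x \<ge> 0" for x by (simp add: f_def)
  have "AE x in Q. ennreal (f x) = RN_deriv Q P x"
    using Q.RN_deriv_finite[OF P.sigma_finite_measure_axioms ac sets]
    by eventually_elim (auto simp: f_def less_top)
  then have "density Q f = density Q (RN_deriv Q P)"
    by (intro density_cong) auto
  then have P: "P = density Q f"
    using Q.density_RN_deriv[OF ac sets] by simp
  have "(\<integral>\<^sup>+x. ennreal (f x) \<partial>Q) = emeasure P (space P)"
    unfolding P by (simp add: emeasure_density cong: nn_integral_cong)
  then have int_f: "integrable Q f"
    by (intro integrableI_nonneg) (auto simp: f0 P.emeasure_space_1)
  have int_f\<alpha>: "integrable Q (\<lambda>x. f x powr \<alpha>)"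
    using I by (intro integrableI_nonneg) (auto simp: le_less_trans)
  have meas: "measure P B = (\<integral>x. f x * indicator B x \<partial>Q)" if "B \<in> sets Q" for B
  proof -
    have "measure P B = (\<integral>x. indicator B x \<partial>P)" using that sets by simp
    also have "\<dots> = (\<integral>x. f x * indicator B x \<partial>Q)"
      unfolding P using that by (subst integral_density) (auto simp: f0)
    finally show ?thesis .
  qed
  \<comment> \<open>Jensen's inequality is applied to \<open>A\<close> and to its complement separately.\<close>
  define C where "C = space Q - A"
  have C: "C \<in> sets Q" unfolding C_def using A by auto
  have space: "space P = space Q" by (rule sets_eq_imp_space_eq[OF sets])
  have PC: "measure P C = 1 - measure P A" and QC: "measure Q C = 1 - measure Q A"
    using A sets P.prob_compl[of A] Q.prob_compl[of A] space by (auto simp: C_def)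
  have "measure P A powr \<alpha> * measure Q A powr (1 - \<alpha>)
      + measure P C powr \<alpha> * measure Q C powr (1 - \<alpha>)
    \<le> (\<integral>x. f x powr \<alpha> * indicator A x \<partial>Q) + (\<integral>x. f x powr \<alpha> * indicator C x \<partial>Q)"
    unfolding meas[OF A] meas[OF C]
    by (intro add_mono Q.powr_integral_le int_f int_f\<alpha> f0 A C assms)
  also have "\<dots> = (\<integral>x. f x powr \<alpha> * indicator A x + f x powr \<alpha> * indicator C x \<partial>Q)"
    by (rule Bochner_Integration.integral_add[symmetric])
       (use A C int_f\<alpha> in \<open>auto intro: integrable_real_mult_indicator\<close>)
  also have "\<dots> = (\<integral>x. f x powr \<alpha> \<partial>Q)"
    by (intro Bochner_Integration.integral_cong) (auto simp: C_def indicator_def)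
  also have "\<dots> \<le> exp ((\<alpha> - 1) * \<delta>)"
  proof -
    have "ennreal (\<integral>x. f x powr \<alpha> \<partial>Q) = (\<integral>\<^sup>+ x. ennreal (f x powr \<alpha>) \<partial>Q)"
      by (rule nn_integral_eq_integral[symmetric]) (auto simp: int_f\<alpha>)
    then show ?thesis using I by (metis ennreal_le_iff exp_ge_zero)
  qed
  finally show ?thesis by (simp add: PC QC)
qed

text \<open>
  The converse of \<open>renyi_ball_bound\<close>, witnessed by the density equal to \<open>p / q\<close> on \<open>A\<close> and
  to \<open>(1 - p) / (1 - q)\<close> off \<open>A\<close>, where \<open>q = measure Q A\<close>.
\<close>
lemma renyi_ball_two_valued:
  assumes "prob_space Q" and "\<alpha> > 1" "\<delta> \<ge> 0" and A: "A \<in> sets Q"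
    and q: "0 < measure Q A" "measure Q A < 1" and p: "0 \<le> p" "p \<le> 1"
    and cost: "p powr \<alpha> * measure Q A powr (1 - \<alpha>)
      + (1 - p) powr \<alpha> * (1 - measure Q A) powr (1 - \<alpha>) \<le> exp ((\<alpha> - 1) * \<delta>)"
  obtains P where "prob_space P" "sets P = sets Q" "renyi_divergence \<alpha> P Q \<le> ereal \<delta>"
    "measure P A = p"
proof -
  interpret Q: prob_space Q by fact
  define q where "q = measure Q A"
  define C where "C = space Q - A"
  have C: "C \<in> sets Q" and QC: "measure Q C = 1 - q"
    unfolding C_def q_def using A Q.prob_compl[of A] by auto
  define f where "f x = p / q * indicator A x + (1 - p) / (1 - q) * indicator C x" for x
  define P where "P = density Q (\<lambda>x. ennreal (f x))"
  have q01: "0 < q" "q < 1" using q by (auto simp: q_def)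
  have f0: "f x \<ge> 0" for x using p q01 by (simp add: f_def)
  have [measurable]: "f \<in> borel_measurable Q" using A C by (simp add: f_def[abs_def])
  have [simp]: "integrable Q (indicat_real A)" "integrable Q (indicat_real C)"
    using A C by (auto intro!: Q.integrable_const_bound[where B = 1] AE_I2)
  have int: "(\<integral>\<^sup>+ x. ennreal (a * indicator A x + b * indicator C x) \<partial>Q) = ennreal (a * q + b * (1 - q))"
    if "a \<ge> 0" "b \<ge> 0" for a b :: real
  proof -
    have "(\<integral>\<^sup>+ x. ennreal (a * indicator A x + b * indicator C x) \<partial>Q)
      = ennreal (\<integral>x. a * indicator A x + b * indicator C x \<partial>Q)"
      using that by (intro nn_integral_eq_integral) auto
    also have "(\<integral>x. a * indicator A x + b * indicator C x \<partial>Q) = a * q + b * (1 - q)"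
      using A C QC by (simp add: q_def)
    finally show ?thesis .
  qed
  have "emeasure P (space P) = (\<integral>\<^sup>+ x. ennreal (f x) \<partial>Q)"
    by (simp add: P_def emeasure_density cong: nn_integral_cong)
  also have "\<dots> = 1"
    unfolding f_def using int[of "p / q" "(1 - p) / (1 - q)"] p q01 by simp
  finally have "prob_space P" by (rule prob_spaceI)
  moreover have "sets P = sets Q" by (simp add: P_def)
  moreover have "renyi_divergence \<alpha> P Q \<le> ereal \<delta>"
  proof -
    have "absolutely_continuous Q P"
      unfolding P_def by (intro absolutely_continuousI_density) auto
    moreover have "(\<integral>\<^sup>+ x. ennreal (enn2real (RN_deriv Q P x) powr \<alpha>) \<partial>Q)
      \<le> ennreal (exp ((\<alpha> - 1) * \<delta>))"
    proof -
      have "AE x in Q. ennreal (f x) = RN_deriv Q P x"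
        by (rule Q.RN_deriv_unique) (auto simp: P_def)
      then have "AE x in Q. ennreal (enn2real (RN_deriv Q P x) powr \<alpha>)
        = ennreal ((p / q) powr \<alpha> * indicator A x + ((1 - p) / (1 - q)) powr \<alpha> * indicator C x)"
        using AE_space
      proof eventually_elim
        case (elim x)
        then have "enn2real (RN_deriv Q P x) = f x"
          using f0 by (metis enn2real_ennreal)
        then show ?case using elim(2) by (auto simp: f_def C_def indicator_def)
      qed
      then have "(\<integral>\<^sup>+ x. ennreal (enn2real (RN_deriv Q P x) powr \<alpha>) \<partial>Q)
        = ennreal ((p / q) powr \<alpha> * q + ((1 - p) / (1 - q)) powr \<alpha> * (1 - q))"
        by (subst nn_integral_cong_AE, assumption) (rule int, simp_all)
      also have "(p / q) powr \<alpha> * q + ((1 - p) / (1 - q)) powr \<alpha> * (1 - q)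
        = p powr \<alpha> * q powr (1 - \<alpha>) + (1 - p) powr \<alpha> * (1 - q) powr (1 - \<alpha>)"
        using p q01 by (simp add: powr_divide powr_diff)
      finally show ?thesis using ennreal_leI[OF cost] by (simp add: q_def del: ennreal_plus)
    qed
    ultimately show ?thesis using assms by (simp add: renyi_divergence_le_iff)
  qed
  moreover have "measure P A = p"
  proof -
    have "measure P A = (\<integral>x. indicator A x \<partial>P)" using A by (simp add: P_def)
    also have "\<dots> = (\<integral>x. f x * indicator A x \<partial>Q)"
      unfolding P_def using A by (subst integral_density) (auto simp: f0)
    also have "\<dots> = (\<integral>x. p / q * indicator A x \<partial>Q)"
      by (intro Bochner_Integration.integral_cong) (auto simp: f_def C_def indicator_def)
    also have "\<dots> = p" using A q01 by (simp add: q_def)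
    finally show ?thesis .
  qed
  ultimately show ?thesis by (rule that)
qed

lemma renyi_divergence_self:
  assumes "prob_space Q" "\<alpha> > 1" "\<delta> \<ge> 0"
  shows "renyi_divergence \<alpha> Q Q \<le> ereal \<delta>"
proof -
  interpret prob_space Q by fact
  have "AE x in Q. 1 = RN_deriv Q Q x"
    by (rule RN_deriv_unique) (auto simp: density_1)
  then have "AE x in Q. ennreal (enn2real (RN_deriv Q Q x) powr \<alpha>) = 1"
    by eventually_elim (metis enn2real_1 ennreal_1 powr_one_eq_one)
  then have "(\<integral>\<^sup>+ x. ennreal (enn2real (RN_deriv Q Q x) powr \<alpha>) \<partial>Q) = (\<integral>\<^sup>+ x. 1 \<partial>Q)"
    by (rule nn_integral_cong_AE)
  then show ?thesis
    using assms by (simp add: renyi_divergence_le_iff absolutely_continuous_def emeasure_space_1)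
qed

section \<open>The worst-case tail\<close>

lemma (in real_distribution) tail_eq_cdf: "measure M {x<..} = 1 - cdf M x"
  using prob_compl[of "{..x}"] by (simp add: cdf_def2 Compl_eq_Diff_UNIV[symmetric])

context
  fixes Q :: "real measure" and \<alpha> \<delta> :: real
  assumes Q: "real_distribution Q" and \<alpha>: "\<alpha> > 1" and \<delta>: "\<delta> > 0"
begin

interpretation Q: real_distribution Q by (rule Q)

lemma worst_case_tail_ge:
  assumes "real_distribution P" "renyi_divergence \<alpha> P Q \<le> ereal \<delta>"
  shows "measure P {x<..} \<le> worst_case_tail \<alpha> \<delta> Q x"
  unfolding worst_case_tail_def
proof (rule cSUP_upper)
  show "bdd_above ((\<lambda>P. measure P {x<..}) `
      {P. real_distribution P \<and> renyi_divergence \<alpha> P Q \<le> ereal \<delta>})"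
    by (rule bdd_aboveI[of _ 1]) (auto simp: real_distribution_def prob_space.prob_le_1)
qed (use assms in simp)

lemma reference_in_renyi_ball: "renyi_divergence \<alpha> Q Q \<le> ereal \<delta>"
  using renyi_divergence_self[of Q \<alpha> \<delta>] Q.prob_space_axioms \<alpha> \<delta> by simp

lemma worst_case_tail_le:
  assumes "\<And>P. real_distribution P \<Longrightarrow> renyi_divergence \<alpha> P Q \<le> ereal \<delta> \<Longrightarrow> measure P {x<..} \<le> B"
  shows "worst_case_tail \<alpha> \<delta> Q x \<le> B"
  unfolding worst_case_tail_def
proof (rule cSUP_least)
  show "{P. real_distribution P \<and> renyi_divergence \<alpha> P Q \<le> ereal \<delta>} \<noteq> {}"
    using Q reference_in_renyi_ball by auto
qed (use assms in simp)

lemma reference_tail_le_worst_case_tail: "measure Q {x<..} \<le> worst_case_tail \<alpha> \<delta> Q x"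
  by (rule worst_case_tail_ge[OF Q reference_in_renyi_ball])

lemma worst_case_tail_le_1: "worst_case_tail \<alpha> \<delta> Q x \<le> 1"
  by (rule worst_case_tail_le) (simp add: real_distribution_def prob_space.prob_le_1)

lemma worst_case_tail_nonneg: "0 \<le> worst_case_tail \<alpha> \<delta> Q x"
  using reference_tail_le_worst_case_tail[of x] measure_nonneg[of Q "{x<..}"] by linarith

lemma worst_case_tail_antimono:
  assumes "x \<le> y"
  shows "worst_case_tail \<alpha> \<delta> Q y \<le> worst_case_tail \<alpha> \<delta> Q x"
proof (rule worst_case_tail_le)
  fix P assume P: "real_distribution P" "renyi_divergence \<alpha> P Q \<le> ereal \<delta>"
  interpret P: real_distribution P by fact
  have "measure P {y<..} \<le> measure P {x<..}"
    using assms by (intro P.finite_measure_mono) auto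
  then show "measure P {y<..} \<le> worst_case_tail \<alpha> \<delta> Q x"
    using worst_case_tail_ge[OF P, of x] by linarith
qed

lemma renyi_ball_tail_bound:
  fixes x :: real
  assumes P: "real_distribution P" "renyi_divergence \<alpha> P Q \<le> ereal \<delta>"
  defines "p \<equiv> measure P {x<..}" and "q \<equiv> measure Q {x<..}"
  shows "p powr \<alpha> * q powr (1 - \<alpha>) + (1 - p) powr \<alpha> * (1 - q) powr (1 - \<alpha>) \<le> exp ((\<alpha> - 1) * \<delta>)"
proof -
  interpret P: real_distribution P by fact
  show ?thesis
    unfolding p_def q_def
    by (rule renyi_ball_bound) (use P \<alpha> \<delta> P.prob_space_axioms Q.prob_space_axioms in auto)
qed

text \<open>
  A bound for all \<open>x\<close>, obtained by dropping the second summand of \<open>renyi_ball_tail_bound\<close>. It makes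
  the worst-case tail vanish at infinity and wherever the reference tail does.
\<close>
lemma worst_case_tail_le_powr:
  "worst_case_tail \<alpha> \<delta> Q x
    \<le> exp ((\<alpha> - 1) * \<delta>) powr (1 / \<alpha>) * measure Q {x<..} powr ((\<alpha> - 1) / \<alpha>)"
proof (rule worst_case_tail_le)
  fix P assume P: "real_distribution P" "renyi_divergence \<alpha> P Q \<le> ereal \<delta>"
  interpret P: real_distribution P by fact
  define p where "p = measure P {x<..}"
  define q where "q = measure Q {x<..}"
  show "p \<le> exp ((\<alpha> - 1) * \<delta>) powr (1 / \<alpha>) * q powr ((\<alpha> - 1) / \<alpha>)"
  proof (cases "q = 0")
    case True
    have "absolutely_continuous Q P"
      using P \<alpha> \<delta> by (simp add: renyi_divergence_le_iff)
    moreover have "{x<..} \<in> null_sets Q"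
      using True by (auto simp: q_def null_sets_def Q.emeasure_eq_measure)
    ultimately have "{x<..} \<in> null_sets P"
      by (auto simp: absolutely_continuous_def)
    then have "p = 0" by (simp add: p_def measure_def null_setsD1)
    then show ?thesis by simp
  next
    case False
    then have q: "q > 0" using measure_nonneg[of Q "{x<..}"] by (simp add: q_def less_le)
    have p: "p \<ge> 0" by (simp add: p_def)
    have "p powr \<alpha> * q powr (1 - \<alpha>) \<le> exp ((\<alpha> - 1) * \<delta>)"
      using renyi_ball_tail_bound[OF P, of x]
      unfolding p_def[symmetric] q_def[symmetric]
      by (smt (verit) mult_nonneg_nonneg powr_ge_zero)
    then have "p powr \<alpha> \<le> exp ((\<alpha> - 1) * \<delta>) * q powr (\<alpha> - 1)"
      using q by (simp add: powr_diff field_simps)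
    then have "(p powr \<alpha>) powr (1 / \<alpha>) \<le> (exp ((\<alpha> - 1) * \<delta>) * q powr (\<alpha> - 1)) powr (1 / \<alpha>)"
      using \<alpha> by (intro powr_mono2) auto
    then show ?thesis
      using p \<alpha> q by (simp add: powr_mult powr_powr)
  qed
qed

text \<open>
  A supremum of right-continuous nonincreasing functions is again right-continuous, so this holds
  for every reference distribution.
\<close>
lemma is_distribution_function_worst_case:
  "is_distribution_function (\<lambda>x. 1 - worst_case_tail \<alpha> \<delta> Q x)" (is "is_distribution_function ?G")
proof -
  have mono: "?G x \<le> ?G y" if "x \<le> y" for x y
    using worst_case_tail_antimono[OF that] by simp
  have right: "continuous (at_right a) ?G" for a
  proof -
    have "(worst_case_tail \<alpha> \<delta> Q \<longlongrightarrow> worst_case_tail \<alpha> \<delta> Q a) (at_right a)"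
    proof (rule order_tendstoI)
      fix l assume "l < worst_case_tail \<alpha> \<delta> Q a"
      then obtain P where P: "real_distribution P" "renyi_divergence \<alpha> P Q \<le> ereal \<delta>"
          "l < measure P {a<..}"
        using worst_case_tail_le[of a l] by (meson not_le)
      interpret P: real_distribution P by fact
      have "((\<lambda>y. 1 - cdf P y) \<longlongrightarrow> 1 - cdf P a) (at_right a)"
        using P.cdf_is_right_cont[of a] by (intro tendsto_intros) (simp add: continuous_within)
      then have "eventually (\<lambda>y. l < measure P {y<..}) (at_right a)"
        using P(3) unfolding P.tail_eq_cdf by (rule order_tendstoD)
      then show "eventually (\<lambda>y. l < worst_case_tail \<alpha> \<delta> Q y) (at_right a)"
        by eventually_elim (rule less_le_trans[OF _ worst_case_tail_ge[OF P(1,2)]])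
    next
      fix u assume "worst_case_tail \<alpha> \<delta> Q a < u"
      then show "eventually (\<lambda>y. worst_case_tail \<alpha> \<delta> Q y < u) (at_right a)"
        using worst_case_tail_antimono
        by (auto simp: eventually_at_right_field intro!: exI[of _ "a + 1"] intro: le_less_trans less_imp_le)
    qed
    then show ?thesis by (auto simp: continuous_within intro!: tendsto_intros)
  qed
  have cdf: "cdf Q = (\<lambda>x. 1 - measure Q {x<..})"
    by (simp add: Q.tail_eq_cdf)
  have bot: "(?G \<longlongrightarrow> 0) at_bot"
  proof (rule tendsto_sandwich[where f = "\<lambda>_. 0" and h = "cdf Q"])
    show "(cdf Q \<longlongrightarrow> 0) at_bot" by (rule Q.cdf_lim_at_bot)
    show "eventually (\<lambda>x. ?G x \<le> cdf Q x) at_bot"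
      using reference_tail_le_worst_case_tail by (simp add: cdf)
    show "eventually (\<lambda>x. 0 \<le> ?G x) at_bot"
      using worst_case_tail_le_1 by simp
  qed simp
  have "(worst_case_tail \<alpha> \<delta> Q \<longlongrightarrow> 0) at_top"
  proof (rule tendsto_sandwich[where f = "\<lambda>_. 0"])
    let ?B = "\<lambda>x. exp ((\<alpha> - 1) * \<delta>) powr (1 / \<alpha>) * measure Q {x<..} powr ((\<alpha> - 1) / \<alpha>)"
    show "eventually (\<lambda>x. worst_case_tail \<alpha> \<delta> Q x \<le> ?B x) at_top"
      using worst_case_tail_le_powr by simp
    have "((\<lambda>x. 1 - cdf Q x) \<longlongrightarrow> 1 - 1) at_top"
      by (intro tendsto_intros Q.cdf_lim_at_top_prob)
    then have "((\<lambda>x. measure Q {x<..}) \<longlongrightarrow> 0) at_top"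
      by (simp add: Q.tail_eq_cdf)
    then have "((\<lambda>x. measure Q {x<..} powr ((\<alpha> - 1) / \<alpha>)) \<longlongrightarrow> 0 powr ((\<alpha> - 1) / \<alpha>)) at_top"
      using \<alpha> by (intro tendsto_powr2 tendsto_const) auto
    then show "(?B \<longlongrightarrow> 0) at_top"
      by (intro tendsto_mult_right_zero) simp
    show "eventually (\<lambda>x. 0 \<le> worst_case_tail \<alpha> \<delta> Q x) at_top"
      using worst_case_tail_nonneg by simp
  qed simp
  then have "(?G \<longlongrightarrow> 1 - 0) at_top" by (intro tendsto_intros)
  then have top: "(?G \<longlongrightarrow> 1) at_top" by simp
  show ?thesis
    unfolding is_distribution_function_def
    using real_distribution_interval_measure[OF mono right bot top]
      cdf_interval_measure[OF mono right bot] by metis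
qed

text \<open>
  As the reference tail \<open>q\<close> vanishes, the worst-case tail behaves like a constant times
  \<open>q powr ((\<alpha> - 1) / \<alpha>)\<close>: the divergence budget left for the tail event tends to
  \<open>exp ((\<alpha> - 1) * \<delta>) - 1\<close>.
\<close>
lemma worst_case_tail_asymptotics:
  assumes lim: "((\<lambda>i. measure Q {X i<..}) \<longlongrightarrow> 0) L"
    and pos: "eventually (\<lambda>i. measure Q {X i<..} > 0) L"
  shows "((\<lambda>i. worst_case_tail \<alpha> \<delta> Q (X i) / measure Q {X i<..} powr ((\<alpha> - 1) / \<alpha>))
    \<longlongrightarrow> (exp ((\<alpha> - 1) * \<delta>) - 1) powr (1 / \<alpha>)) L"
proof -
  define K where "K = exp ((\<alpha> - 1) * \<delta>)"
  define \<beta> where "\<beta> = (\<alpha> - 1) / \<alpha>"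
  define q where "q i = measure Q {X i<..}" for i
  \<comment> \<open>A bound on the tails of all members of the ball at once, which makes the second summand of
    \<open>renyi_ball_tail_bound\<close> uniformly close to \<open>1\<close>.\<close>
  define B where "B i = K powr (1 / \<alpha>) * q i powr \<beta>" for i
  have K: "K > 1" using \<alpha> \<delta> by (simp add: K_def)
  have \<beta>: "\<beta> > 0" "\<beta> * \<alpha> = \<alpha> - 1" using \<alpha> by (auto simp: \<beta>_def)
  have q: "(q \<longlongrightarrow> 0) L" and q_pos: "eventually (\<lambda>i. q i > 0) L"
    using lim pos by (simp_all add: q_def[abs_def])
  have q\<beta>: "((\<lambda>i. q i powr \<beta>) \<longlongrightarrow> 0) L"
    using tendsto_powr2[OF q tendsto_const[of \<beta>]] \<beta> by (simp add: q_def)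
  then have B: "(B \<longlongrightarrow> 0) L"
    unfolding B_def by (rule tendsto_mult_right_zero)
  have B_less: "eventually (\<lambda>i. B i < 1) L"
    using B by (rule order_tendstoD) simp
  have q_less: "eventually (\<lambda>i. q i < 1) L"
    using q by (rule order_tendstoD) simp
  have lim_l: "((\<lambda>i. K - (1 - q i) powr (1 - \<alpha>)) \<longlongrightarrow> K - (1 - 0) powr (1 - \<alpha>)) L"
    by (intro tendsto_intros q) simp
  have lim_u: "((\<lambda>i. K - (1 - B i) powr \<alpha>) \<longlongrightarrow> K - (1 - 0) powr \<alpha>) L"
    by (intro tendsto_intros B) simp
  have l_pos: "eventually (\<lambda>i. K - (1 - q i) powr (1 - \<alpha>) > 0) L"
    using lim_l by (rule order_tendstoD) (use K in simp)
  have "((\<lambda>i. worst_case_tail \<alpha> \<delta> Q (X i) / q i powr \<beta>) \<longlongrightarrow> (K - 1) powr (1 / \<alpha>)) L"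
  proof (rule tendsto_sandwich)
    show "eventually (\<lambda>i. worst_case_tail \<alpha> \<delta> Q (X i) / q i powr \<beta>
        \<le> (K - (1 - B i) powr \<alpha>) powr (1 / \<alpha>)) L"
      using q_pos q_less B_less
    proof eventually_elim
      case (elim i)
      have "worst_case_tail \<alpha> \<delta> Q (X i) \<le> (K - (1 - B i) powr \<alpha>) powr (1 / \<alpha>) * q i powr \<beta>"
      proof (rule worst_case_tail_le)
        fix P assume P: "real_distribution P" "renyi_divergence \<alpha> P Q \<le> ereal \<delta>"
        define p where "p = measure P {X i<..}"
        have p: "p \<ge> 0" by (simp add: p_def)
        have "p \<le> B i"
          using worst_case_tail_ge[OF P] worst_case_tail_le_powr[of "X i"]
          by (auto simp: p_def B_def K_def q_def \<beta>_def intro: order_trans)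
        have "(1 - B i) powr \<alpha> * 1 \<le> (1 - p) powr \<alpha> * (1 - q i) powr (1 - \<alpha>)"
        proof (intro mult_mono)
          show "(1 - B i) powr \<alpha> \<le> (1 - p) powr \<alpha>"
            using \<open>p \<le> B i\<close> elim \<alpha> by (intro powr_mono2) auto
          show "1 \<le> (1 - q i) powr (1 - \<alpha>)"
            using elim \<alpha> powr_mono2'[of "1 - \<alpha>" "1 - q i" 1] by simp
        qed auto
        then have "p powr \<alpha> * q i powr (1 - \<alpha>) \<le> K - (1 - B i) powr \<alpha>"
          using renyi_ball_tail_bound[OF P, of "X i"] by (simp add: p_def q_def K_def)
        then have "p powr \<alpha> \<le> (K - (1 - B i) powr \<alpha>) * q i powr (\<alpha> - 1)"
          using elim by (simp add: powr_diff field_simps)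
        then have "(p powr \<alpha>) powr (1 / \<alpha>) \<le> ((K - (1 - B i) powr \<alpha>) * q i powr (\<alpha> - 1)) powr (1 / \<alpha>)"
          using \<alpha> by (intro powr_mono2) auto
        moreover have "K - (1 - B i) powr \<alpha> \<ge> 0"
        proof -
          have "B i \<ge> 0" using K by (simp add: B_def)
          then have "(1 - B i) powr \<alpha> \<le> 1 powr \<alpha>"
            using elim \<alpha> by (intro powr_mono2) auto
          then show ?thesis using K by simp
        qed
        ultimately show "p \<le> (K - (1 - B i) powr \<alpha>) powr (1 / \<alpha>) * q i powr \<beta>"
          using p \<alpha> by (simp add: powr_mult powr_powr \<beta>_def)
      qed
      then show ?case using elim by (simp add: field_simps)
    qed
    have "((\<lambda>i. (K - (1 - q i) powr (1 - \<alpha>)) powr (1 / \<alpha>) * q i powr \<beta>)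
        \<longlongrightarrow> (K - (1 - 0) powr (1 - \<alpha>)) powr (1 / \<alpha>) * 0) L"
      by (intro tendsto_mult tendsto_powr lim_l q\<beta> tendsto_const) (use K in simp)
    then have "eventually (\<lambda>i. (K - (1 - q i) powr (1 - \<alpha>)) powr (1 / \<alpha>) * q i powr \<beta> < 1) L"
      by (rule order_tendstoD) simp
    then show "eventually (\<lambda>i. (K - (1 - q i) powr (1 - \<alpha>)) powr (1 / \<alpha>)
        \<le> worst_case_tail \<alpha> \<delta> Q (X i) / q i powr \<beta>) L"
      using q_pos q_less l_pos
    proof eventually_elim
      case (elim i)
      \<comment> \<open>Bounding \<open>(1 - p) powr \<alpha>\<close> by \<open>1\<close> in the constraint makes it solvable for \<open>p\<close>.\<close>
      define p where "p = (K - (1 - q i) powr (1 - \<alpha>)) powr (1 / \<alpha>) * q i powr \<beta>"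
      have p: "0 \<le> p" "p \<le> 1" using elim by (auto simp: p_def)
      have "p powr \<alpha> = (K - (1 - q i) powr (1 - \<alpha>)) * q i powr (\<alpha> - 1)"
        using elim \<alpha> \<beta> by (simp add: p_def powr_mult powr_powr)
      then have "p powr \<alpha> * q i powr (1 - \<alpha>) = K - (1 - q i) powr (1 - \<alpha>)"
        using elim by (simp add: powr_diff)
      moreover have "(1 - p) powr \<alpha> * (1 - q i) powr (1 - \<alpha>) \<le> 1 * (1 - q i) powr (1 - \<alpha>)"
        using p \<alpha> powr_mono2[of \<alpha> "1 - p" 1] by (intro mult_right_mono) auto
      ultimately have "p powr \<alpha> * q i powr (1 - \<alpha>) + (1 - p) powr \<alpha> * (1 - q i) powr (1 - \<alpha>)
          \<le> exp ((\<alpha> - 1) * \<delta>)"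
        by (simp add: K_def)
      then obtain P where P: "prob_space P" "sets P = sets Q" "renyi_divergence \<alpha> P Q \<le> ereal \<delta>"
          "measure P {X i<..} = p"
        using renyi_ball_two_valued[OF Q.prob_space_axioms \<alpha>, of \<delta> "{X i<..}" p] \<delta> elim p
        by (auto simp: q_def)
      have "real_distribution P"
        using P by (simp add: real_distribution_def real_distribution_axioms_def)
      from worst_case_tail_ge[OF this P(3), of "X i"] show ?case
        using elim P(4) by (simp add: p_def field_simps)
    qed
    show "((\<lambda>i. (K - (1 - q i) powr (1 - \<alpha>)) powr (1 / \<alpha>)) \<longlongrightarrow> (K - 1) powr (1 / \<alpha>)) L"
      using tendsto_powr[OF lim_l tendsto_const[of "1 / \<alpha>"]] K by simp
    show "((\<lambda>i. (K - (1 - B i) powr \<alpha>) powr (1 / \<alpha>)) \<longlongrightarrow> (K - 1) powr (1 / \<alpha>)) L"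
      using tendsto_powr[OF lim_u tendsto_const[of "1 / \<alpha>"]] K by simp
  qed
  then show ?thesis by (simp add: K_def q_def \<beta>_def)
qed

end

lemma worst_case_tail_eq_0:
  assumes "real_distribution Q" "\<alpha> > 1" "\<delta> > 0" "measure Q {x<..} = 0"
  shows "worst_case_tail \<alpha> \<delta> Q x = 0"
  using worst_case_tail_le_powr[OF assms(1-3), of x] worst_case_tail_nonneg[OF assms(1-3), of x] assms(4)
  by simp

lemma worst_case_tail_eq_1:
  assumes "real_distribution Q" "\<alpha> > 1" "\<delta> > 0" "measure Q {x<..} = 1"
  shows "worst_case_tail \<alpha> \<delta> Q x = 1"
  using reference_tail_le_worst_case_tail[OF assms(1-3), of x] worst_case_tail_le_1[OF assms(1-3), of x] assms(4)
  by simp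

section \<open>The exponent of an extreme value distribution\<close>

text \<open>
  The exponent \<open>- ln (extreme_value_cdf \<gamma> y)\<close> of the standard distribution. It has this meaning only
  on the support \<open>1 + \<gamma> * y > 0\<close>.
\<close>
definition gev_exponent :: "real \<Rightarrow> real \<Rightarrow> real" where
  "gev_exponent \<gamma> y = (if \<gamma> = 0 then exp (- y) else (1 + \<gamma> * y) powr (- 1 / \<gamma>))"

lemma gev_exponent_pos: "0 < 1 + \<gamma> * y \<Longrightarrow> 0 < gev_exponent \<gamma> y"
  by (simp add: gev_exponent_def)

lemma extreme_value_cdf_eq_exp:
  "0 < 1 + \<gamma> * y \<Longrightarrow> extreme_value_cdf \<gamma> y = exp (- gev_exponent \<gamma> y)"
  by (simp add: extreme_value_cdf_def gev_exponent_def)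

text \<open>
  This autonomous equation is the same for all \<open>\<gamma>\<close>, so that the derivatives of the
  distribution function need no case distinction on \<open>\<gamma>\<close>.
\<close>
lemma has_field_derivative_gev_exponent:
  assumes "0 < 1 + \<gamma> * y"
  shows "(gev_exponent \<gamma> has_field_derivative - (gev_exponent \<gamma> y powr (1 + \<gamma>))) (at y)"
proof (cases "\<gamma> = 0")
  case True
  then have "gev_exponent \<gamma> = (\<lambda>y. exp (- y))" by (auto simp: gev_exponent_def)
  then show ?thesis using True by (auto intro!: derivative_eq_intros)
next
  case False
  then have eq: "gev_exponent \<gamma> = (\<lambda>y. (1 + \<gamma> * y) powr (- 1 / \<gamma>))"
    by (auto simp: gev_exponent_def)
  have "((\<lambda>y. (1 + \<gamma> * y) powr (- 1 / \<gamma>)) has_field_derivative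
      (- 1 / \<gamma>) * (1 + \<gamma> * y) powr (- 1 / \<gamma> - 1) * \<gamma>) (at y)"
    using assms by (auto intro!: derivative_eq_intros)
  moreover have "(- 1 / \<gamma>) * (1 + \<gamma>) = - 1 / \<gamma> - 1"
    using False by (simp add: field_simps)
  ultimately show ?thesis
    using False by (simp add: eq powr_powr)
qed

text \<open>
  Raising the exponent to the power \<open>\<beta>\<close> changes the shape from \<open>\<gamma>\<close> to \<open>\<gamma> / \<beta>\<close>.
\<close>
lemma gev_exponent_powr:
  assumes "\<beta> > 0" "0 < 1 + \<gamma> * y"
  shows "gev_exponent \<gamma> y powr \<beta> = gev_exponent (\<gamma> / \<beta>) (\<beta> * y)"
  using assms by (simp add: gev_exponent_def powr_powr exp_powr_real mult.commute)

text \<open>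
  The translation part of the affine map \<open>x \<mapsto> m powr \<gamma> * x + gev_shift \<gamma> m\<close>, which divides the
  exponent by \<open>m\<close> and respects the support. The value at \<open>\<gamma> = 0\<close> is the limit of the general one.
\<close>
definition gev_shift :: "real \<Rightarrow> real \<Rightarrow> real" where
  "gev_shift \<gamma> m = (if \<gamma> = 0 then ln m else (m powr \<gamma> - 1) / \<gamma>)"

lemma gev_norming_support:
  assumes "m > 0"
  shows "1 + \<gamma> * (m powr \<gamma> * x + gev_shift \<gamma> m) = m powr \<gamma> * (1 + \<gamma> * x)"
  using assms by (simp add: gev_shift_def field_simps)

lemma gev_exponent_norming:
  assumes m: "m > 0" and x: "0 < 1 + \<gamma> * x"
  shows "gev_exponent \<gamma> (m powr \<gamma> * x + gev_shift \<gamma> m) = gev_exponent \<gamma> x / m"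
proof (cases "\<gamma> = 0")
  case True
  then show ?thesis using m by (simp add: gev_exponent_def gev_shift_def exp_diff exp_minus field_simps exp_add)
next
  case False
  then have "gev_exponent \<gamma> (m powr \<gamma> * x + gev_shift \<gamma> m) = (m powr \<gamma> * (1 + \<gamma> * x)) powr (- 1 / \<gamma>)"
    unfolding gev_norming_support[OF m, symmetric] by (simp add: gev_exponent_def)
  also have "\<dots> = m powr (- 1) * (1 + \<gamma> * x) powr (- 1 / \<gamma>)"
    using m x False by (simp add: powr_mult powr_powr)
  finally show ?thesis using False m by (simp add: gev_exponent_def powr_minus_divide)
qed

section \<open>The von Mises condition for GEV distributions\<close>

text \<open>
  A GEV distribution function of shape \<open>\<gamma>\<close>, given as an affine rescaling of the standard one.
\<close>
locale gev_cdf =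
  fixes \<gamma> a b :: real and F :: "real \<Rightarrow> real"
  assumes a: "a > 0" and F: "F x = extreme_value_cdf \<gamma> (a * x + b)"
begin

text \<open>
  The interior of the support of the distribution, an open half-line or the whole line.
\<close>
definition support :: "real set" where
  "support = {x. 0 < 1 + \<gamma> * (a * x + b)}"

text \<open>
  The exponent \<open>- ln F\<close>, with this meaning on \<open>support\<close> only.
\<close>
definition expo :: "real \<Rightarrow> real" where
  "expo x = gev_exponent \<gamma> (a * x + b)"

lemma open_support: "open support"
  unfolding support_def by (intro open_Collect_less continuous_intros)

lemma expo_pos: "x \<in> support \<Longrightarrow> expo x > 0"
  by (simp add: support_def expo_def gev_exponent_pos)

lemma F_eq: "x \<in> support \<Longrightarrow> F x = exp (- expo x)"
  by (simp add: support_def expo_def F extreme_value_cdf_eq_exp)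

lemma DERIV_expo:
  assumes "x \<in> support"
  shows "(expo has_field_derivative - (a * expo x powr (1 + \<gamma>))) (at x)"
proof -
  have "((\<lambda>x. gev_exponent \<gamma> (a * x + b)) has_field_derivative
      - (gev_exponent \<gamma> (a * x + b) powr (1 + \<gamma>)) * a) (at x)"
    by (rule DERIV_chain2[OF has_field_derivative_gev_exponent])
      (use assms in \<open>auto simp: support_def intro!: derivative_eq_intros\<close>)
  then show ?thesis by (simp add: expo_def[abs_def] mult.commute)
qed

lemma DERIV_F:
  assumes "x \<in> support"
  shows "(F has_field_derivative a * expo x powr (1 + \<gamma>) * exp (- expo x)) (at x)"
proof (rule has_field_derivative_transform_within_open[OF _ open_support assms])
  show "((\<lambda>x. exp (- expo x)) has_field_derivative a * expo x powr (1 + \<gamma>) * exp (- expo x)) (at x)"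
    using assms by (auto intro!: derivative_eq_intros DERIV_expo)
qed (simp add: F_eq)

lemma deriv_F: "x \<in> support \<Longrightarrow> deriv F x = a * expo x powr (1 + \<gamma>) * exp (- expo x)"
  by (rule DERIV_imp_deriv[OF DERIV_F])

lemma deriv_F_differentiable:
  assumes x: "x \<in> support"
  shows "deriv F differentiable (at x)"
proof -
  define h where "h v = a * v powr (1 + \<gamma>) * exp (- v)" for v
  have "(h has_field_derivative a * ((1 + \<gamma>) * expo x powr \<gamma>) * exp (- expo x)
      + a * expo x powr (1 + \<gamma>) * (- exp (- expo x))) (at (expo x))"
    unfolding h_def[abs_def] using expo_pos[OF x]
    by (auto intro!: derivative_eq_intros)
  from DERIV_chain2[OF this DERIV_expo[OF x]]
  have "(deriv F has_field_derivative (a * ((1 + \<gamma>) * expo x powr \<gamma>) * exp (- expo x)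
      + a * expo x powr (1 + \<gamma>) * (- exp (- expo x))) * (- (a * expo x powr (1 + \<gamma>)))) (at x)"
    by (rule has_field_derivative_transform_within_open[OF _ open_support x])
       (simp add: h_def deriv_F)
  then show ?thesis using real_differentiable_def by blast
qed

text \<open>
  With \<open>u = expo\<close>, the reciprocal hazard rate is \<open>(exp u - 1) * u powr (- (1 + \<gamma>)) / a\<close>, a function
  of \<open>u\<close> alone, so the differential equation for \<open>u\<close> gives a derivative in terms of \<open>u\<close> alone.
\<close>
lemma deriv_reciprocal_hazard:
  assumes x: "x \<in> support"
  shows "deriv (\<lambda>t. (1 - F t) / deriv F t) x
    = - exp (expo x) + (1 + \<gamma>) * ((exp (expo x) - 1) / expo x)"
proof (rule DERIV_imp_deriv)
  define u where "u = expo x"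
  have u: "u > 0" using expo_pos[OF x] by (simp add: u_def)
  define r where "r v = (exp v - 1) * v powr (- (1 + \<gamma>)) / a" for v
  have "((\<lambda>v. exp v - 1) has_field_derivative exp u) (at u)"
    by (auto intro!: derivative_eq_intros)
  from DERIV_cdivide[OF DERIV_mult[OF this has_real_derivative_powr[OF u]]]
  have "(r has_field_derivative (exp u * u powr (- (1 + \<gamma>))
      + - (1 + \<gamma>) * u powr (- (1 + \<gamma>) - 1) * (exp u - 1)) / a) (at u)"
    unfolding r_def[abs_def] .
  from DERIV_chain2[OF this[unfolded u_def] DERIV_expo[OF x], folded u_def]
  have "((\<lambda>t. (1 - F t) / deriv F t) has_field_derivative (exp u * u powr (- (1 + \<gamma>))
      + - (1 + \<gamma>) * u powr (- (1 + \<gamma>) - 1) * (exp u - 1)) / a * - (a * u powr (1 + \<gamma>))) (at x)"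
  proof (rule has_field_derivative_transform_within_open[OF _ open_support x])
    fix t assume t: "t \<in> support"
    have "expo t powr (1 + \<gamma>) > 0" using expo_pos[OF t] by simp
    then show "r (expo t) = (1 - F t) / deriv F t"
      using a unfolding deriv_F[OF t] F_eq[OF t] r_def powr_minus exp_minus
      by (simp add: divide_simps)
  qed
  also have "(exp u * u powr (- (1 + \<gamma>))
      + - (1 + \<gamma>) * u powr (- (1 + \<gamma>) - 1) * (exp u - 1)) / a * - (a * u powr (1 + \<gamma>))
    = - (exp u * (u powr (- (1 + \<gamma>)) * u powr (1 + \<gamma>)))
      + (1 + \<gamma>) * (exp u - 1) * (u powr (- (1 + \<gamma>) - 1) * u powr (1 + \<gamma>))"
  proof -
    have *: "(E * p + - g * q * e) / a * - (a * w) = - (E * (p * w)) + g * e * (q * w)"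
      for E p g q e w :: real
      using a by (simp add: field_simps)
    show ?thesis by (rule *)
  qed
  also have "u powr (- (1 + \<gamma>)) * u powr (1 + \<gamma>) = 1"
    using u by (simp add: powr_add[symmetric])
  also have "u powr (- (1 + \<gamma>) - 1) * u powr (1 + \<gamma>) = 1 / u"
    using u by (simp add: powr_add[symmetric] powr_minus_divide)
  finally show "((\<lambda>t. (1 - F t) / deriv F t) has_field_derivative
      - exp (expo x) + (1 + \<gamma>) * ((exp (expo x) - 1) / expo x)) (at x)"
    by (simp add: u_def)
qed

lemma von_mises_limit:
  assumes supp: "eventually (\<lambda>x. x \<in> support) L" and lim: "(expo \<longlongrightarrow> 0) L"
  shows "((\<lambda>x. deriv (\<lambda>t. (1 - F t) / deriv F t) x) \<longlongrightarrow> \<gamma>) L"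
proof -
  have "filterlim expo (at 0) L"
    using lim by (auto simp: filterlim_at intro!: eventually_mono[OF supp] dest: expo_pos)
  from filterlim_compose[OF tendsto_exp_minus_one_divide this]
  have "((\<lambda>x. - exp (expo x) + (1 + \<gamma>) * ((exp (expo x) - 1) / expo x))
      \<longlongrightarrow> - exp 0 + (1 + \<gamma>) * 1) L"
    by (intro tendsto_intros lim)
  moreover have "eventually (\<lambda>x. - exp (expo x) + (1 + \<gamma>) * ((exp (expo x) - 1) / expo x)
      = deriv (\<lambda>t. (1 - F t) / deriv F t) x) L"
    using supp by eventually_elim (simp add: deriv_reciprocal_hazard)
  ultimately show ?thesis by (auto dest: Lim_transform_eventually)
qed

lemma F_regular:
  assumes "x \<in> support"
  shows "F differentiable (at x) \<and> deriv F differentiable (at x) \<and> deriv F x > 0"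
proof (intro conjI)
  show "F differentiable (at x)" using DERIV_F[OF assms] real_differentiable_def by blast
  show "deriv F x > 0" using expo_pos[OF assms] a by (simp add: deriv_F[OF assms])
qed (rule deriv_F_differentiable[OF assms])

lemma right_endpoint_nonneg:
  assumes "\<gamma> \<ge> 0"
  shows "right_endpoint F = \<infinity>"
proof -
  have "F x < 1" for x
    by (cases "x \<in> support")
       (use assms expo_pos[of x] in \<open>auto simp: F_eq F support_def extreme_value_cdf_def\<close>)
  then have "{x. F x < 1} = UNIV" by auto
  moreover have "(SUP x. ereal x) = \<infinity>"
    by (rule SUP_PInfty) (metis UNIV_I ereal_less_eq(3) real_arch_simple)
  ultimately show ?thesis by (simp add: right_endpoint_def)
qed

lemma expo_tendsto_nonneg:
  assumes "\<gamma> \<ge> 0"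
  shows "(expo \<longlongrightarrow> 0) at_top"
proof -
  have lin: "filterlim (\<lambda>x. c * x + d) at_top at_top" if "c > 0" for c d :: real
    unfolding filterlim_at_top
  proof
    fix Z
    show "eventually (\<lambda>x. Z \<le> c * x + d) at_top"
      using eventually_ge_at_top[of "(Z - d) / c"]
      by eventually_elim (use that in \<open>simp add: field_simps\<close>)
  qed
  show ?thesis
  proof (cases "\<gamma> = 0")
    case True
    have "((\<lambda>x. exp (- (a * x + b))) \<longlongrightarrow> 0) at_top"
      using lin[OF a, of b] unfolding filterlim_uminus_at_top by (rule filterlim_compose[OF exp_at_bot])
    then show ?thesis unfolding expo_def[abs_def] by (simp add: True gev_exponent_def)
  next
    case False
    then have "((\<lambda>x. (\<gamma> * a * x + (1 + \<gamma> * b)) powr (- 1 / \<gamma>)) \<longlongrightarrow> 0) at_top"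
      using assms a by (intro tendsto_neg_powr lin) auto
    then show ?thesis using False by (simp add: expo_def[abs_def] gev_exponent_def algebra_simps)
  qed
qed

text \<open>
  The right endpoint of the distribution when \<open>\<gamma> < 0\<close>; the formula is used only in that case.
\<close>
definition upper_end :: real where
  "upper_end = (- 1 / \<gamma> - b) / a"

lemma support_neg:
  assumes "\<gamma> < 0"
  shows "x \<in> support \<longleftrightarrow> x < upper_end"
proof -
  have "x < upper_end \<longleftrightarrow> a * x + b < - 1 / \<gamma>"
    using a by (simp add: upper_end_def pos_less_divide_eq less_diff_eq mult.commute)
  also have "\<dots> \<longleftrightarrow> - 1 < (a * x + b) * \<gamma>"
    using assms by (rule neg_less_divide_eq)
  also have "\<dots> \<longleftrightarrow> x \<in> support"
    by (auto simp: support_def mult.commute)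
  finally show ?thesis by simp
qed

lemma support_nonneg:
  assumes "\<gamma> \<ge> 0" "(- 1 / \<gamma> - b) / a < x"
  shows "x \<in> support"
proof (cases "\<gamma> = 0")
  case True
  then show ?thesis unfolding support_def by simp
next
  case False
  then have "\<gamma> > 0" using assms by simp
  moreover have "- 1 / \<gamma> < a * x + b"
    using a assms by (simp add: pos_divide_less_eq diff_less_eq mult.commute)
  ultimately have "- 1 < (a * x + b) * \<gamma>"
    by (simp only: pos_divide_less_eq)
  then show ?thesis by (simp add: support_def mult.commute)
qed

lemma right_endpoint_neg:
  assumes "\<gamma> < 0"
  shows "right_endpoint F = ereal upper_end"
proof -
  have "F x < 1 \<longleftrightarrow> x < upper_end" for x
    using expo_pos[of x] assms
    by (cases "x \<in> support")
       (auto simp: F_eq F extreme_value_cdf_def support_neg[OF assms, symmetric] support_def)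
  then have "right_endpoint F = (SUP x\<in>{..<upper_end}. ereal x)"
    by (simp add: right_endpoint_def lessThan_def)
  also have "\<dots> = ereal upper_end"
  proof (rule SUP_eqI)
    fix y assume y: "\<And>x. x \<in> {..<upper_end} \<Longrightarrow> ereal x \<le> y"
    show "ereal upper_end \<le> y"
    proof (rule ccontr)
      assume "\<not> ereal upper_end \<le> y"
      then obtain z where "y < ereal z" "ereal z < ereal upper_end"
        using ereal_dense2[of y "ereal upper_end"] by (auto simp: not_le)
      then show False using y[of z] by simp
    qed
  qed simp
  finally show ?thesis .
qed

lemma expo_tendsto_neg:
  assumes "\<gamma> < 0"
  shows "(expo \<longlongrightarrow> 0) (at_left upper_end)"
proof -
  have "((\<lambda>x. 1 + \<gamma> * (a * x + b)) \<longlongrightarrow> 1 + \<gamma> * (a * upper_end + b)) (at_left upper_end)"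
    by (intro tendsto_intros)
  moreover have "1 + \<gamma> * (a * upper_end + b) = 0"
    using assms a by (simp add: upper_end_def field_simps)
  ultimately have "((\<lambda>x. 1 + \<gamma> * (a * x + b)) \<longlongrightarrow> 0) (at_left upper_end)" by simp
  moreover have "eventually (\<lambda>x. 0 \<le> 1 + \<gamma> * (a * x + b)) (at_left upper_end)"
    using support_neg[OF assms] by (auto simp: support_def eventually_at_filter less_imp_le)
  ultimately have "((\<lambda>x. (1 + \<gamma> * (a * x + b)) powr (- 1 / \<gamma>)) \<longlongrightarrow> 0 powr (- 1 / \<gamma>)) (at_left upper_end)"
    using assms by (intro tendsto_powr2 tendsto_const) (auto simp: divide_neg_neg)
  then show ?thesis using assms by (simp add: expo_def[abs_def] gev_exponent_def)
qed

lemma regular_near_endpoint: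
  "\<exists>y. ereal y < right_endpoint F \<and>
    (\<forall>x. y < x \<and> ereal x < right_endpoint F \<longrightarrow>
      F differentiable (at x) \<and> deriv F differentiable (at x) \<and> deriv F x > 0)"
proof (cases "\<gamma> < 0")
  case True
  then show ?thesis
    using F_regular support_neg[OF True] by (intro exI[of _ "upper_end - 1"]) (simp add: right_endpoint_neg)
next
  case False
  \<comment> \<open>For \<open>\<gamma> > 0\<close> this is the lower endpoint; for \<open>\<gamma> = 0\<close> any real number would do.\<close>
  define y where "y = (- 1 / \<gamma> - b) / a"
  have "x \<in> support" if "y < x" for x
    using False that by (auto simp: y_def intro: support_nonneg)
  then show ?thesis
    using False F_regular by (intro exI[of _ y]) (simp add: right_endpoint_nonneg)
qed

lemma von_mises_at_endpoint:
  "((\<lambda>x. deriv (\<lambda>t. (1 - F t) / deriv F t) (real_of_ereal x)) \<longlongrightarrow> \<gamma>) (at_left (right_endpoint F))"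
proof (cases "\<gamma> < 0")
  case True
  have "eventually (\<lambda>x. x \<in> support) (at_left upper_end)"
    using support_neg[OF True] by (auto simp: eventually_at_filter)
  from von_mises_limit[OF this expo_tendsto_neg[OF True]] show ?thesis
    by (simp add: right_endpoint_neg[OF True] at_left_ereal filterlim_filtermap)
next
  case False
  then have g: "\<gamma> \<ge> 0" by simp
  have "eventually (\<lambda>x. x \<in> support) at_top"
    using eventually_gt_at_top[of "(- 1 / \<gamma> - b) / a"]
    by eventually_elim (rule support_nonneg[OF g])
  from von_mises_limit[OF this expo_tendsto_nonneg[OF g]] show ?thesis
    by (simp add: right_endpoint_nonneg[OF g] at_left_PInf filterlim_filtermap)
qed

end

section \<open>Domain of attraction of the worst-case distribution\<close>

text \<open>
  The norming constants come from \<open>gev_exponent_norming\<close> with \<open>m = n c\<close>, where \<open>c\<close> is the constant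
  in \<open>worst_case_tail_asymptotics\<close>; hence the limit is the standard distribution, without a
  further affine change of argument.
\<close>
lemma worst_case_gev_max_domain:
  fixes \<gamma> a0 b0 \<alpha> \<delta> :: real
  assumes Q: "real_distribution Q" and a0: "a0 > 0"
    and cdf: "\<And>x. cdf Q x = extreme_value_cdf \<gamma> (a0 * x + b0)"
    and \<alpha>: "\<alpha> > 1" and \<delta>: "\<delta> > 0"
  shows "in_max_domain_of_attraction (\<lambda>x. 1 - worst_case_tail \<alpha> \<delta> Q x) (\<alpha> / (\<alpha> - 1) * \<gamma>)"
proof -
  interpret Q: real_distribution Q by fact
  define \<beta> where "\<beta> = (\<alpha> - 1) / \<alpha>"
  define \<gamma>' where "\<gamma>' = \<alpha> / (\<alpha> - 1) * \<gamma>"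
  define c where "c = (exp ((\<alpha> - 1) * \<delta>) - 1) powr (1 / \<alpha>)"
  define W where "W = worst_case_tail \<alpha> \<delta> Q"
  have \<beta>: "\<beta> > 0" using \<alpha> by (simp add: \<beta>_def)
  have \<gamma>': "\<gamma>' = \<gamma> / \<beta>" by (simp add: \<gamma>'_def \<beta>_def)
  have c: "c > 0" using \<alpha> \<delta> by (simp add: c_def)
  \<comment> \<open>The value at \<open>n = 0\<close> is irrelevant and only has to be positive.\<close>
  define m where "m n = c * real (max 1 n)" for n :: nat
  have m: "m n > 0" for n using c by (simp add: m_def)
  define z where "z n x = m n powr \<gamma>' * x + gev_shift \<gamma>' (m n)" for n x
  define A where "A n = m n powr \<gamma>' / (\<beta> * a0)" for n
  define B where "B n = (gev_shift \<gamma>' (m n) / \<beta> - b0) / a0" for n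
  have A: "A n > 0" for n using m[of n] \<beta> a0 by (simp add: A_def)
  have arg: "a0 * (A n * x + B n) + b0 = z n x / \<beta>" for n x
    using a0 \<beta> by (simp add: A_def B_def z_def field_simps)
  have supp: "1 + \<gamma> * (z n x / \<beta>) = m n powr \<gamma>' * (1 + \<gamma>' * x)" for n x
    using gev_norming_support[OF m, of \<gamma>' n x] by (simp add: z_def \<gamma>')
  have tail: "measure Q {A n * x + B n<..} = 1 - extreme_value_cdf \<gamma> (z n x / \<beta>)" for n x
    by (simp add: Q.tail_eq_cdf cdf arg)
  have "(\<lambda>n. (1 - W (A n * x + B n)) ^ n) \<longlonglongrightarrow> extreme_value_cdf \<gamma>' x" for x
  proof (cases "0 < 1 + \<gamma>' * x")
    case False
    \<comment> \<open>The points \<open>A n * x + B n\<close> then lie outside the open support of the reference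
      distribution too, so that its tail there, and with it the worst-case tail, is \<open>0\<close> or \<open>1\<close>.\<close>
    have out: "\<not> 0 < 1 + \<gamma> * (z n x / \<beta>)" for n
      unfolding supp using False m[of n] by (simp add: zero_less_mult_iff)
    have "\<gamma> \<noteq> 0" using out[of 0] by auto
    show ?thesis
    proof (cases "\<gamma> > 0")
      case True
      then have "measure Q {A n * x + B n<..} = 1" for n
        using out[of n] by (simp add: tail extreme_value_cdf_def)
      then have "W (A n * x + B n) = 1" for n
        unfolding W_def by (intro worst_case_tail_eq_1 Q \<alpha> \<delta>)
      moreover have "extreme_value_cdf \<gamma>' x = 0"
        using False True \<beta> by (simp add: extreme_value_cdf_def \<gamma>')
      ultimately show ?thesis
        by (auto intro!: tendsto_eventually eventually_mono[OF eventually_gt_at_top[of 0]])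
    next
      case neg: False
      then have "measure Q {A n * x + B n<..} = 0" for n
        using out[of n] \<open>\<gamma> \<noteq> 0\<close> by (simp add: tail extreme_value_cdf_def)
      then have "W (A n * x + B n) = 0" for n
        unfolding W_def by (intro worst_case_tail_eq_0 Q \<alpha> \<delta>)
      moreover have "\<not> \<gamma>' > 0" "\<gamma>' \<noteq> 0"
        using neg \<open>\<gamma> \<noteq> 0\<close> \<beta> by (auto simp: \<gamma>' zero_less_divide_iff)
      then have "extreme_value_cdf \<gamma>' x = 1"
        using False by (simp add: extreme_value_cdf_def)
      ultimately show ?thesis by simp
    qed
  next
    case True
    define v where "v = gev_exponent \<gamma>' x"
    define u where "u n = gev_exponent \<gamma> (z n x / \<beta>)" for n
    define q where "q n = measure Q {A n * x + B n<..}" for n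
    have v: "v > 0" using True by (simp add: v_def gev_exponent_pos)
    have ins: "0 < 1 + \<gamma> * (z n x / \<beta>)" for n
      unfolding supp using True m[of n] by simp
    have u: "u n > 0" for n using gev_exponent_pos[OF ins] by (simp add: u_def)
    have q: "q n = 1 - exp (- u n)" for n
      by (simp add: q_def tail extreme_value_cdf_eq_exp[OF ins] u_def)
    have q_pos: "q n > 0" for n using u[of n] by (simp add: q)
    have u\<beta>: "u n powr \<beta> = v / m n" for n
      using gev_exponent_powr[OF \<beta> ins, of n] gev_exponent_norming[OF m True, of n] \<beta>
      by (simp add: u_def v_def z_def \<gamma>')
    have "(\<lambda>n. v / c / real n) \<longlonglongrightarrow> 0" by (rule lim_const_over_n)
    moreover have nm: "eventually (\<lambda>n. v / c / real n = u n powr \<beta>) sequentially"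
      using eventually_gt_at_top[of 0] by eventually_elim (simp add: u\<beta> m_def)
    ultimately have "(\<lambda>n. u n powr \<beta>) \<longlonglongrightarrow> 0"
      by (rule Lim_transform_eventually)
    then have "(\<lambda>n. (u n powr \<beta>) powr (1 / \<beta>)) \<longlonglongrightarrow> 0 powr (1 / \<beta>)"
      using \<beta> by (intro tendsto_powr2 tendsto_const) auto
    then have u0: "u \<longlonglongrightarrow> 0"
      using \<beta> u by (simp add: powr_powr less_imp_le)
    have "filterlim u (at 0) sequentially"
      using u0 u by (auto simp: filterlim_at intro!: always_eventually) (metis less_irrefl)
    from filterlim_compose[OF one_minus_exp_minus_asymp this]
    have qu: "(\<lambda>n. q n / u n) \<longlonglongrightarrow> 1" by (simp add: q)
    have "(\<lambda>n. 1 - exp (- u n)) \<longlonglongrightarrow> 1 - exp (- 0)" by (intro tendsto_intros u0)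
    then have q0: "q \<longlonglongrightarrow> 0" by (simp add: q[abs_def])
    have "(\<lambda>n. W (A n * x + B n) / q n powr \<beta>) \<longlonglongrightarrow> c"
      unfolding W_def q_def \<beta>_def c_def
      by (rule worst_case_tail_asymptotics[OF Q \<alpha> \<delta>])
         (use q0 q_pos in \<open>simp_all add: q_def[abs_def]\<close>)
    then have "(\<lambda>n. W (A n * x + B n) / q n powr \<beta> * (q n / u n) powr \<beta> * (v / c))
        \<longlonglongrightarrow> c * 1 powr \<beta> * (v / c)"
      by (intro tendsto_intros qu) auto
    moreover have "eventually (\<lambda>n. W (A n * x + B n) / q n powr \<beta> * (q n / u n) powr \<beta> * (v / c)
        = real n * W (A n * x + B n)) sequentially"
      using nm eventually_gt_at_top[of 0]
    proof eventually_elim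
      case (elim n)
      have "v / c = real n * u n powr \<beta>"
        using elim(2) unfolding elim(1)[symmetric] by simp
      then show ?case
        using q_pos[of n] u[of n] by (simp add: powr_divide)
    qed
    ultimately have "(\<lambda>n. real n * W (A n * x + B n)) \<longlonglongrightarrow> c * 1 powr \<beta> * (v / c)"
      by (rule Lim_transform_eventually)
    then have "(\<lambda>n. real n * W (A n * x + B n)) \<longlonglongrightarrow> v" using c by simp
    then have "(\<lambda>n. (1 - W (A n * x + B n)) ^ n) \<longlonglongrightarrow> exp (- v)"
      by (rule one_minus_power_tendsto_exp) (simp add: W_def worst_case_tail_nonneg[OF Q \<alpha> \<delta>])
    then show ?thesis by (simp add: v_def extreme_value_cdf_eq_exp[OF True])
  qed
  then show ?thesis
    unfolding in_max_domain_of_attraction_def \<gamma>'_def[symmetric]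
    using is_distribution_function_worst_case[OF Q \<alpha> \<delta>] A
    by (intro conjI exI[of _ A] exI[of _ B] exI[of _ 1] exI[of _ 0]) (auto simp: W_def)
qed

theorem theorem5:
  fixes \<gamma>_ref a0 b0 :: real
    and P_GEV :: "real measure"
    and F :: "real \<Rightarrow> real"
    and x_F :: ereal
  assumes "real_distribution P_GEV"
    and "a0 > 0"
    and "F = cdf P_GEV"
    and "\<And>x. F x = extreme_value_cdf \<gamma>_ref (a0 * x + b0)"
    and "x_F = right_endpoint F"
  shows "(\<exists>y::real. ereal y < x_F \<and>
            (\<forall>x::real. y < x \<and> ereal x < x_F \<longrightarrow>
               F differentiable (at x) \<and> deriv F differentiable (at x) \<and> deriv F x > 0)) \<and>
         ((\<lambda>x. deriv (\<lambda>t. (1 - F t) / deriv F t) (real_of_ereal x)) \<longlongrightarrow> \<gamma>_ref) (at_left x_F) \<and>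
         (\<forall>\<alpha> \<delta> :: real. \<alpha> > 1 \<and> \<delta> > 0 \<longrightarrow>
            in_max_domain_of_attraction (\<lambda>x. 1 - worst_case_tail \<alpha> \<delta> P_GEV x)
              (\<alpha> / (\<alpha> - 1) * \<gamma>_ref))"
proof -
  interpret gev_cdf \<gamma>_ref a0 b0 F
    by unfold_locales (use assms in auto)
  have "in_max_domain_of_attraction (\<lambda>x. 1 - worst_case_tail \<alpha> \<delta> P_GEV x) (\<alpha> / (\<alpha> - 1) * \<gamma>_ref)"
    if "\<alpha> > 1" "\<delta> > 0" for \<alpha> \<delta> :: real
    using worst_case_gev_max_domain[OF assms(1,2) _ that, of \<gamma>_ref b0] assms(3,4) by simp
  then show ?thesis
    unfolding assms(5) using regular_near_endpoint von_mises_at_endpoint by blast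
qed

end
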